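(* Let $f\in C^1[0,1]$, $\alpha\ge 1$ and $\beta\in[0,1]$. Then for every integer $n\ge 2$ and every $x\in[0,1]$ $$\left|L_{n,\beta}^{(\alpha)}(f;x)-f(x)\right|\le\sqrt{\frac{(14+\beta^2)\alpha}{4n}}\cdot\left\{\|f'\|+\omega\!\left(f';\frac1{\sqrt n}\right)\cdot\left(1+\sqrt{\frac{(14+\beta^2)\alpha}{4}}\right)\right\}.$$
   Context: $C^1[0,1]$ is the set of functions $f$ on $[0,1]$ whose derivative $f'$ is continuous on $[0,1]$; $\|g\|=\max_{x\in[0,1]}|g(x)|$; $\omega(g;\delta)=\sup\{|g(s)-g(t)|: s,t\in[0,1],\ |s-t|\le\delta\}$ is the usual modulus of continuity. For $n\ge 1$, $0\le k\le n$, let $p_{n,k}(x)=\binom nk x^k(1-x)^{n-k}$, $J_{n,k}(x)=\sum_{i=k}^n p_{n,i}(x)$ and $J_{n,n+1}(x)=0$. For $\alpha\ge1$ put $Q_{n,k}^{(\alpha)}(x)=J_{n,k}(x)^{\alpha}-J_{n,k+1}(x)^{\alpha}$. For $m\ge 1$, $1\le k\le m-1$, $\beta\in[0,1]$ and $f\in C[0,1]$ (continuous on $[0,1]$), $$F_{m,k}^{(\beta)}(f)=\frac{1}{B(mk,m(m-k))}\int_0^1 t^{mk-1}(1-t)^{m(m-k)-1}f\!\left(\beta t+(1-\beta)\tfrac km\right)dt,$$ where $B(\cdot,\cdot)$ is the Beta function; for $k=m$ put $F_{m,m}^{(\beta)}(f)=f(1)$. For $n\ge 2$, $$L_{n,\beta}^{(\alpha)}(f;x)=f(0)Q_{n,0}^{(\alpha)}(x)+\sum_{k=1}^{n-1}Q_{n,k}^{(\alpha)}(x)F_{n-1,k}^{(\beta)}(f)+f(1)Q_{n,n}^{(\alpha)}(x).$$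 *)

theory Defs
  imports "HOL-Analysis.Analysis"
begin

definition sup_norm01 :: "(real \<Rightarrow> real) \<Rightarrow> real" where
  "sup_norm01 g = (SUP x\<in>{0..1}. \<bar>g x\<bar>)"

definition modulus01 :: "(real \<Rightarrow> real) \<Rightarrow> real \<Rightarrow> real" where
  "modulus01 g \<delta> = Sup {\<bar>g s - g t\<bar> | s t. s \<in> {0..1} \<and> t \<in> {0..1} \<and> \<bar>s - t\<bar> \<le> \<delta>}"

text \<open>
  At the endpoints of the interval the derivative below is the one-sided one. Only the values
  of \<open>f\<close> and \<open>f'\<close> on \<open>{0..1}\<close> matter.
\<close>
definition C1_on01 :: "(real \<Rightarrow> real) \<Rightarrow> (real \<Rightarrow> real) \<Rightarrow> bool" where
  "C1_on01 f f' \<longleftrightarrow>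
     (\<forall>x\<in>{0..1}. (f has_real_derivative f' x) (at x within {0..1})) \<and> continuous_on {0..1} f'"

definition bernstein_p :: "nat \<Rightarrow> nat \<Rightarrow> real \<Rightarrow> real" where
  "bernstein_p n k x = real (n choose k) * x ^ k * (1 - x) ^ (n - k)"

text \<open>For \<open>k = n + 1\<close> the sum is empty, so the value is \<open>0\<close>.\<close>
definition bezier_J :: "nat \<Rightarrow> nat \<Rightarrow> real \<Rightarrow> real" where
  "bezier_J n k x = (\<Sum>i = k..n. bernstein_p n i x)"

definition bezier_Q :: "real \<Rightarrow> nat \<Rightarrow> nat \<Rightarrow> real \<Rightarrow> real" where
  "bezier_Q \<alpha> n k x = bezier_J n k x powr \<alpha> - bezier_J n (k + 1) x powr \<alpha>"

text \<open>
  Intended for \<open>1 \<le> k \<le> m\<close>. If \<open>k < m\<close>, both exponents are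
  non-negative integers, so the natural number subtractions do not truncate.
\<close>
definition beta_F :: "real \<Rightarrow> nat \<Rightarrow> nat \<Rightarrow> (real \<Rightarrow> real) \<Rightarrow> real" where
  "beta_F \<beta> m k f =
     (if k = m then f 1
      else 1 / Beta (real (m * k)) (real (m * (m - k))) *
           integral {0..1} (\<lambda>t. t ^ (m * k - 1) * (1 - t) ^ (m * (m - k) - 1) *
                                f (\<beta> * t + (1 - \<beta>) * (real k / real m))))"

definition bezier_L :: "real \<Rightarrow> real \<Rightarrow> nat \<Rightarrow> (real \<Rightarrow> real) \<Rightarrow> real \<Rightarrow> real" where
  "bezier_L \<alpha> \<beta> n f x =
     f 0 * bezier_Q \<alpha> n 0 x
     + (\<Sum>k = 1..n - 1. bezier_Q \<alpha> n k x * beta_F \<beta> (n - 1) k f)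
     + f 1 * bezier_Q \<alpha> n n x"

end

theory Submission
  imports Defs
begin

text \<open>
  The operator is positive, reproduces constants, and \<open>Q\<^sub>n\<^sub>,\<^sub>k \<le> \<alpha> p\<^sub>n\<^sub>,\<^sub>k\<close> because \<open>u \<mapsto> u\<^sup>\<alpha>\<close> is
  \<open>\<alpha>\<close>-Lipschitz on \<open>[0,1]\<close>. Its second central moment is therefore at most \<open>\<alpha>\<close> times that of the
  operator with \<open>\<alpha> = 1\<close>, and the latter is at most \<open>(14 + \<beta>\<^sup>2) / (4 n)\<close> by the second moments of
  the binomial and Beta distributions. Let \<open>c\<^sup>2\<close> be the resulting bound. As \<open>f\<close> is
  \<open>\<parallel>f'\<parallel>\<close>-Lipschitz, \<open>\<bar>t - x\<bar> \<le> c/2 + (t - x)\<^sup>2 / (2 c)\<close> already gives the error bound \<open>c \<parallel>f'\<parallel>\<close>;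
  the term with the modulus of continuity is only needed to be nonnegative.
\<close>

section \<open>Beta integrals and the functional \<open>beta_F\<close>\<close>

lemma has_integral_Beta_nat:
  fixes a b :: nat
  assumes "a > 0" and "b > 0"
  shows "((\<lambda>t. t ^ (a - 1) * (1 - t) ^ (b - 1)) has_integral Beta (real a) (real b)) {0..1}"
\<comment> \<open>The endpoints are excluded because \<open>0 ^ 0 = 1\<close> while
  \<open>0 powr 0 = 0\<close>: for \<open>a = 1\<close> or \<open>b = 1\<close> the two integrands
  differ there.\<close>
proof (rule has_integral_spike_finite[of "{0, 1}"])
  show "((\<lambda>t. t powr (real a - 1) * (1 - t) powr (real b - 1)) has_integral Beta (real a) (real b)) {0..1}"
    using assms by (intro has_integral_Beta_real) auto
  show "t ^ (a - 1) * (1 - t) ^ (b - 1) = t powr (real a - 1) * (1 - t) powr (real b - 1)"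
    if "t \<in> {0..1} - {0, 1}" for t
  proof -
    have "t > 0" "1 - t > 0"
      using that by auto
    moreover have "real a - 1 = real (a - 1)" "real b - 1 = real (b - 1)"
      using assms by auto
    ultimately show ?thesis
      by (simp only: powr_realpow)
  qed
qed auto

lemma Beta_nat_pos:
  fixes a b :: nat
  assumes "a > 0" and "b > 0"
  shows "Beta (real a) (real b) > 0"
  using assms by (simp add: Beta_def Gamma_real_pos)

text \<open>Expanding the square leaves the weight times \<open>t\<close> and
  \<open>t\<^sup>2\<close>, which raise the first Beta parameter by one and by two; the recurrence
  of \<open>Beta\<close> then gives both moments. An affine \<open>p * t + q\<close> is allowed
  because \<open>beta_F\<close> evaluates at affine points.\<close>

lemma has_integral_Beta_weight_square:
  fixes a b :: nat and p q :: real
  assumes a: "a > 0" and b: "b > 0"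
  defines "s \<equiv> real a + real b"
  shows "((\<lambda>t. t ^ (a - 1) * (1 - t) ^ (b - 1) * (p * t + q)\<^sup>2) has_integral
    Beta (real a) (real b) *
      (p\<^sup>2 * (real a * (real a + 1) / (s * (s + 1))) + 2 * p * q * (real a / s) + q\<^sup>2)) {0..1}"
proof -
  let ?B = "Beta (real a) (real b)"
  have s: "s > 0"
    using a by (simp add: s_def)
  \<comment> \<open>Away from the poles of Gamma the recurrence
    \<open>(a + b) * Beta (a + 1) b = a * Beta a b\<close> holds; it is applied at \<open>a\<close>
    and at \<open>a + 1\<close>.\<close>
  have notin: "real a \<notin> \<int>\<^sub>\<le>\<^sub>0" "real a + 1 \<notin> \<int>\<^sub>\<le>\<^sub>0"
    using a by (auto elim!: nonpos_Ints_cases)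
  have B1: "Beta (real (a + 1)) (real b) = ?B * (real a / s)"
    using Beta_plus1_left[OF notin(1), of "real b"] s by (simp add: s_def field_simps)
  have "(s + 1) * Beta (real (a + 2)) (real b) = (real a + 1) * Beta (real (a + 1)) (real b)"
    using Beta_plus1_left[OF notin(2), of "real b"] by (simp add: s_def algebra_simps)
  then have "Beta (real (a + 2)) (real b) = (real a + 1) * Beta (real (a + 1)) (real b) / (s + 1)"
    using s by (simp add: field_simps)
  then have B2: "Beta (real (a + 2)) (real b) = ?B * (real a * (real a + 1) / (s * (s + 1)))"
    unfolding B1 by simp
  have w1: "t ^ (a + 1 - 1) = t ^ (a - 1) * t" and w2: "t ^ (a + 2 - 1) = t ^ (a - 1) * t\<^sup>2" for t :: real
    using a by (simp_all flip: power_Suc2 power_add)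
  have "((\<lambda>t. p\<^sup>2 * (t ^ (a + 2 - 1) * (1 - t) ^ (b - 1)) + 2 * p * q * (t ^ (a + 1 - 1) * (1 - t) ^ (b - 1))
      + q\<^sup>2 * (t ^ (a - 1) * (1 - t) ^ (b - 1))) has_integral
      p\<^sup>2 * Beta (real (a + 2)) (real b) + 2 * p * q * Beta (real (a + 1)) (real b) + q\<^sup>2 * ?B) {0..1}"
    by (intro has_integral_add has_integral_mult_right has_integral_Beta_nat) (use a b in auto)
  then show ?thesis
    unfolding w1 w2 B1 B2 by (simp add: power2_sum algebra_simps power2_eq_square)
qed

text \<open>With \<open>a = m k\<close> and \<open>b = m (m - k)\<close> the Beta distribution has mean \<open>k/m\<close> and variance
  \<open>(k/m) (1 - k/m) / (m\<^sup>2 + 1)\<close>, which explains the bound.\<close>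

lemma beta_F_quadratic_bound:
  fixes f :: "real \<Rightarrow> real"
  assumes cont: "continuous_on {0..1} f" and \<beta>: "\<beta> \<in> {0..1}" and k: "1 \<le> k" "k \<le> m"
    and bound: "\<And>u. u \<in> {0..1} \<Longrightarrow> \<bar>f u - y\<bar> \<le> A + D * (u - x)\<^sup>2"
  defines "\<mu> \<equiv> real k / real m"
  shows "\<bar>beta_F \<beta> m k f - y\<bar> \<le> A + D * ((\<mu> - x)\<^sup>2 + \<beta>\<^sup>2 * (\<mu> * (1 - \<mu>)) / ((real m)\<^sup>2 + 1))"
proof (cases "k = m")
  case True
  \<comment> \<open>Here the functional is evaluation at 1, and the variance term vanishes with
    \<open>1 - \<mu>\<close>.\<close>
  then have "\<mu> = 1"
    using k by (simp add: \<mu>_def)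
  then show ?thesis
    using bound[of 1] True by (simp add: beta_F_def)
next
  case False
  define a b where "a = m * k" and "b = m * (m - k)"
  have m: "m > 0"
    using k by simp
  have a: "a > 0" and b: "b > 0"
    using k False by (auto simp: a_def b_def)
  have \<mu>: "0 \<le> \<mu>" "\<mu> \<le> 1"
    using k by (auto simp: \<mu>_def)
  have ra: "real a = (real m)\<^sup>2 * \<mu>"
    using m by (simp add: a_def \<mu>_def power2_eq_square)
  have rs: "real a + real b = (real m)\<^sup>2"
    using k by (simp add: a_def b_def of_nat_diff power2_eq_square algebra_simps)
  define w where "w t = t ^ (a - 1) * (1 - t) ^ (b - 1)" for t :: real
  define g where "g t = \<beta> * t + (1 - \<beta>) * \<mu>" for t :: real
  define B where "B = Beta (real a) (real b)"
  define V where "V = (\<mu> - x)\<^sup>2 + \<beta>\<^sup>2 * (\<mu> * (1 - \<mu>)) / ((real m)\<^sup>2 + 1)"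
  have B: "B > 0"
    unfolding B_def using a b by (rule Beta_nat_pos)
  have g: "g t \<in> {0..1}" if "t \<in> {0..1}" for t
  proof -
    have "g t \<le> \<beta> * 1 + (1 - \<beta>) * 1"
      unfolding g_def using that \<mu> \<beta> by (intro add_mono mult_left_mono) auto
    moreover have "0 \<le> g t"
      unfolding g_def using that \<mu> \<beta> by simp
    ultimately show ?thesis
      by simp
  qed
  have w: "w t \<ge> 0" if "t \<in> {0..1}" for t
    using that by (simp add: w_def)
  have int_w: "(w has_integral B) {0..1}"
    unfolding w_def B_def using a b by (rule has_integral_Beta_nat)
  have cont_fg: "continuous_on {0..1} (\<lambda>t. f (g t))"
    by (rule continuous_on_compose2[OF cont]) (use g in \<open>auto simp: g_def intro!: continuous_intros\<close>)
  have int_wf: "(\<lambda>t. w t * f (g t)) integrable_on {0..1}"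
    by (rule integrable_continuous_real)
      (auto simp: w_def intro!: continuous_intros cont_fg)
  define N where "N = (real m)\<^sup>2"
  have N: "N > 0"
    using m by (simp add: N_def)
  \<comment> \<open>Second moment about \<open>x\<close> as squared bias plus variance: the random
    point is \<beta> times a Beta variable with mean \<open>\<mu>\<close> plus a constant, so its
    mean stays \<open>\<mu>\<close> and its variance is scaled by
    \<open>\<beta>\<^sup>2\<close>.\<close>
  have V_eq: "\<beta>\<^sup>2 * (real a * (real a + 1) / ((real a + real b) * (real a + real b + 1)))
      + 2 * \<beta> * ((1 - \<beta>) * \<mu> - x) * (real a / (real a + real b)) + ((1 - \<beta>) * \<mu> - x)\<^sup>2 = V"
  proof -
    have e1: "real a / (real a + real b) = \<mu>"
      unfolding rs unfolding ra using N by (simp add: N_def)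
    have e2: "real a * (real a + 1) / ((real a + real b) * (real a + real b + 1))
        = \<mu>\<^sup>2 + \<mu> * (1 - \<mu>) / (N + 1)"
      unfolding rs unfolding ra N_def[symmetric] using N by (simp add: divide_simps) algebra
    show ?thesis
      unfolding e1 e2 V_def N_def[symmetric] by (simp add: power2_eq_square algebra_simps)
  qed
  have "((\<lambda>t. w t * (\<beta> * t + ((1 - \<beta>) * \<mu> - x))\<^sup>2) has_integral B * V) {0..1}"
    unfolding V_eq[symmetric] w_def B_def by (rule has_integral_Beta_weight_square[OF a b])
  then have int_wV: "((\<lambda>t. w t * (g t - x)\<^sup>2) has_integral B * V) {0..1}"
    by (simp add: g_def algebra_simps)
  have int_diff: "((\<lambda>t. w t * f (g t) - w t * y) has_integral (integral {0..1} (\<lambda>t. w t * f (g t)) - B * y)) {0..1}"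
    by (intro has_integral_diff has_integral_mult_left int_w integrable_integral int_wf)
  have int_bound: "((\<lambda>t. w t * A + D * (w t * (g t - x)\<^sup>2)) has_integral (B * A + D * (B * V))) {0..1}"
    by (intro has_integral_add has_integral_mult_left has_integral_mult_right int_w int_wV)
  have "norm (integral {0..1} (\<lambda>t. w t * f (g t) - w t * y))
      \<le> integral {0..1} (\<lambda>t. w t * A + D * (w t * (g t - x)\<^sup>2))"
  proof (rule integral_norm_bound_integral)
    fix t :: real assume t: "t \<in> {0..1}"
    have "norm (w t * f (g t) - w t * y) = w t * \<bar>f (g t) - y\<bar>"
      using w[OF t] by (simp add: abs_mult flip: right_diff_distrib)
    also have "\<dots> \<le> w t * (A + D * (g t - x)\<^sup>2)"
      using w[OF t] bound[OF g[OF t]] by (rule mult_left_mono[rotated])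
    finally show "norm (w t * f (g t) - w t * y) \<le> w t * A + D * (w t * (g t - x)\<^sup>2)"
      by (simp add: algebra_simps)
  qed (use int_diff int_bound in \<open>auto intro: has_integral_integrable\<close>)
  then have "\<bar>integral {0..1} (\<lambda>t. w t * f (g t)) - B * y\<bar> \<le> B * (A + D * V)"
    using int_diff int_bound by (simp add: integral_unique algebra_simps)
  also have "integral {0..1} (\<lambda>t. w t * f (g t)) - B * y = B * (beta_F \<beta> m k f - y)"
    using False B by (simp add: beta_F_def w_def g_def B_def a_def b_def \<mu>_def field_simps)
  finally have "B * \<bar>beta_F \<beta> m k f - y\<bar> \<le> B * (A + D * V)"
    using B by (simp add: abs_mult)
  then show ?thesis
    using B unfolding V_def[symmetric] by (rule mult_left_le_imp_le)
qed

section \<open>Bernstein weights and the Bezier basis\<close>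

lemma bernstein_p_eq_Bernstein: "bernstein_p n k x = Bernstein n k x"
  by (simp add: bernstein_p_def Bernstein_def)

lemma bezier_J_rec:
  assumes "k \<le> n"
  shows "bezier_J n k x = bernstein_p n k x + bezier_J n (k + 1) x"
  using assms by (simp add: bezier_J_def sum.atLeast_Suc_atMost)

lemma bezier_J_0: "bezier_J n 0 x = 1"
  by (simp add: bezier_J_def bernstein_p_eq_Bernstein flip: atMost_atLeast0)

lemma bezier_J_range:
  assumes "x \<in> {0..1}"
  shows "bezier_J n k x \<in> {0..1}"
proof -
  have p: "bernstein_p n i x \<ge> 0" for i
    using assms by (simp add: bernstein_p_def)
  have "bezier_J n k x \<le> bezier_J n 0 x"
    unfolding bezier_J_def by (intro sum_mono2) (auto simp: p)
  then show ?thesis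
    by (simp add: bezier_J_0) (simp add: bezier_J_def p sum_nonneg)
qed

text \<open>Mean value theorem: the derivative \<open>\<alpha> * z powr (\<alpha> - 1)\<close> is at
  most \<alpha> for \<open>0 < z \<le> 1\<close>. Differentiability is used only at interior points,
  so \<open>v = 0\<close> is covered.\<close>

lemma powr_diff_le:
  fixes u v \<alpha> :: real
  assumes "0 \<le> v" "v \<le> u" "u \<le> 1" "\<alpha> \<ge> 1"
  shows "u powr \<alpha> - v powr \<alpha> \<le> \<alpha> * (u - v)"
proof (cases "v = u")
  case False
  with assms have "v < u"
    by simp
  have "continuous_on {v..u} (\<lambda>t. t powr \<alpha>)"
    using assms by (intro continuous_on_powr') (auto intro: continuous_intros)
  moreover have "(\<lambda>t. t powr \<alpha>) differentiable (at t)" if "v < t" for t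
    using that assms has_real_derivative_powr[of t \<alpha>] real_differentiable_def by fastforce
  ultimately obtain l z where z: "v < z" "z < u" "DERIV (\<lambda>t. t powr \<alpha>) z :> l"
      and eq: "u powr \<alpha> - v powr \<alpha> = (u - v) * l"
    using MVT[OF \<open>v < u\<close>, of "\<lambda>t. t powr \<alpha>"] by blast
  have "l = \<alpha> * z powr (\<alpha> - 1)"
    using z assms by (intro DERIV_unique[OF z(3) has_real_derivative_powr]) simp
  also have "\<dots> \<le> \<alpha> * 1"
    using z assms by (intro mult_left_mono powr_le1) auto
  finally show ?thesis
    using eq \<open>v < u\<close> by (simp add: mult.commute)
qed simp

lemma bezier_Q_nonneg:
  assumes "x \<in> {0..1}" "\<alpha> \<ge> 1" "k \<le> n"
  shows "0 \<le> bezier_Q \<alpha> n k x"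
proof -
  have "bernstein_p n k x \<ge> 0"
    using assms by (simp add: bernstein_p_def)
  then show ?thesis
    unfolding bezier_Q_def using assms bezier_J_range[of x n "k + 1"] bezier_J_rec[of k n x]
    by (simp add: powr_mono2)
qed

text \<open>Consecutive tails \<open>bezier_J\<close> differ by exactly one Bernstein weight, which
  becomes \<open>u - v\<close> in \<open>powr_diff_le\<close>.\<close>

lemma bezier_Q_le:
  assumes "x \<in> {0..1}" "\<alpha> \<ge> 1" "k \<le> n"
  shows "bezier_Q \<alpha> n k x \<le> \<alpha> * Bernstein n k x"
proof -
  have "Bernstein n k x \<ge> 0"
    using assms by (simp add: Bernstein_nonneg)
  then show ?thesis
    using powr_diff_le[of "bezier_J n (k + 1) x" "bezier_J n k x" \<alpha>] assms
      bezier_J_range[of x n "k + 1"] bezier_J_range[of x n k] bezier_J_rec[of k n x]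
    by (simp add: bezier_Q_def bernstein_p_eq_Bernstein)
qed

text \<open>Telescoping from \<open>1 powr \<alpha>\<close> down to the empty tail, where
  \<open>0 powr \<alpha> = 0\<close>.\<close>

lemma sum_bezier_Q: "(\<Sum>k\<le>n. bezier_Q \<alpha> n k x) = 1"
proof -
  have "(\<Sum>k\<le>n. bezier_Q \<alpha> n k x) = bezier_J n 0 x powr \<alpha> - bezier_J n (Suc n) x powr \<alpha>"
    unfolding bezier_Q_def Suc_eq_plus1[symmetric] by (rule sum_telescope)
  then show ?thesis
    by (simp add: bezier_J_0) (simp add: bezier_J_def)
qed

lemma sum_Bernstein_square_dist:
  assumes "n > 0"
  shows "(\<Sum>k\<le>n. Bernstein n k x * (real k / real n - x)\<^sup>2) = x * (1 - x) / real n"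
proof -
  \<comment> \<open>Writing \<open>k\<^sup>2\<close> as \<open>k * (k - 1) + k\<close> reduces the
    binomial variance to the known factorial moments.\<close>
  have "(\<Sum>k\<le>n. Bernstein n k x * (real k / real n - x)\<^sup>2)
      = (\<Sum>k\<le>n. (real k * (real k - 1) * Bernstein n k x) / (real n)\<^sup>2
          + (real k * Bernstein n k x) * (1 / (real n)\<^sup>2 - 2 * x / real n) + Bernstein n k x * x\<^sup>2)"
    using assms by (intro sum.cong refl) (simp add: power2_eq_square field_simps)
  also have "\<dots> = real n * (real n - 1) * x\<^sup>2 / (real n)\<^sup>2
      + real n * x * (1 / (real n)\<^sup>2 - 2 * x / real n) + x\<^sup>2"
    by (simp add: sum.distrib flip: sum_divide_distrib sum_distrib_right)
  also have "\<dots> = x * (1 - x) / real n"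
    using assms by (simp add: power2_eq_square field_simps)
  finally show ?thesis .
qed

section \<open>Second moment of the Bezier operator\<close>

lemma power2_sum_le: "(a + b)\<^sup>2 \<le> 2 * a\<^sup>2 + 2 * b\<^sup>2" for a b :: real
  using zero_le_power2[of "a - b"] unfolding power2_sum power2_diff by linarith

lemma quarter_bound: "x * (1 - x) \<le> 1 / 4" for x :: real
  using zero_le_power2[of "x - 1 / 2"] by (simp add: power2_eq_square algebra_simps)

text \<open>Puts the two boundary terms and the Beta terms under one index, so that the operator
  becomes a weighted average over \<open>k \<le> n\<close>. Both \<open>k = n - 1\<close> and
  \<open>k = n\<close> yield \<open>f 1\<close>, the former through the case \<open>k = m\<close> of
  \<open>beta_F\<close>.\<close>

definition node_functional :: "real \<Rightarrow> nat \<Rightarrow> (real \<Rightarrow> real) \<Rightarrow> nat \<Rightarrow> real" where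
  "node_functional \<beta> n f k =
     (if k = 0 then f 0 else if k = n then f 1 else beta_F \<beta> (n - 1) k f)"

lemma bezier_L_eq_sum:
  assumes "n \<ge> 2"
  shows "bezier_L \<alpha> \<beta> n f x = (\<Sum>k\<le>n. bezier_Q \<alpha> n k x * node_functional \<beta> n f k)"
proof -
  have "{..n} = insert 0 (insert n {1..n - 1})"
    using assms by auto
  then have "(\<Sum>k\<le>n. bezier_Q \<alpha> n k x * node_functional \<beta> n f k) = bezier_Q \<alpha> n 0 x * f 0
      + (bezier_Q \<alpha> n n x * f 1 + (\<Sum>k = 1..n - 1. bezier_Q \<alpha> n k x * node_functional \<beta> n f k))"
    using assms by (simp add: node_functional_def)
  also have "(\<Sum>k = 1..n - 1. bezier_Q \<alpha> n k x * node_functional \<beta> n f k)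
      = (\<Sum>k = 1..n - 1. bezier_Q \<alpha> n k x * beta_F \<beta> (n - 1) k f)"
    using assms by (intro sum.cong refl) (auto simp: node_functional_def)
  finally show ?thesis
    by (simp add: bezier_L_def)
qed

text \<open>The Beta means are \<open>k / (n - 1)\<close>, whereas the binomial moments concern
  \<open>k / n\<close>. The two differ by at most \<open>1 / n\<close>, which costs the factor 2 and
  the term \<open>2 / n\<^sup>2\<close>; the Beta variance costs the last term.\<close>

lemma node_functional_quadratic_bound:
  fixes f :: "real \<Rightarrow> real"
  assumes cont: "continuous_on {0..1} f" and \<beta>: "\<beta> \<in> {0..1}" and n: "n \<ge> 2" and k: "k \<le> n"
    and D: "D \<ge> 0"
    and bound: "\<And>u. u \<in> {0..1} \<Longrightarrow> \<bar>f u - y\<bar> \<le> A + D * (u - x)\<^sup>2"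
  shows "\<bar>node_functional \<beta> n f k - y\<bar>
    \<le> A + D * (2 * (real k / real n - x)\<^sup>2 + 2 / (real n)\<^sup>2 + \<beta>\<^sup>2 / (4 * real n))"
proof -
  have D_mono: "z \<le> A + D * v \<Longrightarrow> v \<le> v' \<Longrightarrow> z \<le> A + D * v'" for z v v'
    using mult_left_mono[OF _ D, of v v'] by linarith
  \<comment> \<open>For \<open>k = 0\<close> and \<open>k = n\<close> the node \<open>k / n\<close>
    is the evaluation point itself, so the extra terms only enlarge the bound.\<close>
  have ends: "(r - x)\<^sup>2 \<le> 2 * (r - x)\<^sup>2 + 2 / (real n)\<^sup>2 + \<beta>\<^sup>2 / (4 * real n)" for r :: real
    by (simp add: add_increasing2)
  consider "k = 0" | "k = n" | "1 \<le> k" "k \<le> n - 1"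
    using k by linarith
  then show ?thesis
  proof cases
    case 1
    with D_mono[OF bound[of 0] ends] show ?thesis
      by (simp add: node_functional_def)
  next
    case 2
    with D_mono[OF bound[of 1] ends] n show ?thesis
      by (simp add: node_functional_def)
  next
    case 3
    define m where "m = n - 1"
    define \<mu> where "\<mu> = real k / real m"
    have m: "m > 0" "real n = real m + 1"
      using n by (auto simp: m_def)
    have \<mu>: "0 \<le> \<mu>" "\<mu> \<le> 1"
      using 3 m by (auto simp: \<mu>_def m_def)
    have "\<mu> - real k / real n = \<mu> / real n"
      using m by (simp add: \<mu>_def field_simps)
    then have eq: "\<mu> - x = (real k / real n - x) + \<mu> / real n"
      by simp
    have "(\<mu> - x)\<^sup>2 \<le> 2 * (real k / real n - x)\<^sup>2 + 2 * (\<mu> / real n)\<^sup>2"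
      unfolding eq by (rule power2_sum_le)
    also have "(\<mu> / real n)\<^sup>2 \<le> (1 / real n)\<^sup>2"
      using \<mu> by (intro power_mono divide_right_mono) auto
    finally have first: "(\<mu> - x)\<^sup>2 \<le> 2 * (real k / real n - x)\<^sup>2 + 2 / (real n)\<^sup>2"
      by (simp add: power_divide)
    \<comment> \<open>From \<open>m \<le> m\<^sup>2\<close> the variance denominator
      \<open>m\<^sup>2 + 1\<close> is at least \<open>m + 1 = n\<close>.\<close>
    have "real m * 1 \<le> real m * real m"
      using m by (intro mult_left_mono) auto
    then have "real n \<le> (real m)\<^sup>2 + 1"
      using m by (simp add: power2_eq_square)
    then have "\<beta>\<^sup>2 * (\<mu> * (1 - \<mu>)) / ((real m)\<^sup>2 + 1) \<le> \<beta>\<^sup>2 * (1 / 4) / real n"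
      using n \<mu> by (intro frac_le mult_left_mono quarter_bound) auto
    then have "(\<mu> - x)\<^sup>2 + \<beta>\<^sup>2 * (\<mu> * (1 - \<mu>)) / ((real m)\<^sup>2 + 1)
        \<le> 2 * (real k / real n - x)\<^sup>2 + 2 / (real n)\<^sup>2 + \<beta>\<^sup>2 / (4 * real n)"
      using first by simp
    moreover have "\<bar>beta_F \<beta> m k f - y\<bar> \<le> A + D * ((\<mu> - x)\<^sup>2 + \<beta>\<^sup>2 * (\<mu> * (1 - \<mu>)) / ((real m)\<^sup>2 + 1))"
      unfolding \<mu>_def using 3 by (intro beta_F_quadratic_bound cont \<beta> bound) (auto simp: m_def)
    moreover have "node_functional \<beta> n f k = beta_F \<beta> m k f"
      using 3 n by (auto simp: node_functional_def m_def)
    ultimately show ?thesis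
      using D_mono by metis
  qed
qed

lemma sum_bezier_Q_second_moment:
  assumes x: "x \<in> {0..1}" and \<alpha>: "\<alpha> \<ge> 1" and n: "n \<ge> 2"
  shows "(\<Sum>k\<le>n. bezier_Q \<alpha> n k x * (2 * (real k / real n - x)\<^sup>2 + 2 / (real n)\<^sup>2 + \<beta>\<^sup>2 / (4 * real n)))
    \<le> (14 + \<beta>\<^sup>2) * \<alpha> / (4 * real n)"
proof -
  define E where "E = 2 / (real n)\<^sup>2 + \<beta>\<^sup>2 / (4 * real n)"
  have E: "E \<ge> 0"
    by (simp add: E_def)
  have "(\<Sum>k\<le>n. bezier_Q \<alpha> n k x * (2 * (real k / real n - x)\<^sup>2 + E))
      \<le> (\<Sum>k\<le>n. \<alpha> * Bernstein n k x * (2 * (real k / real n - x)\<^sup>2 + E))"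
    using E x \<alpha> by (intro sum_mono mult_right_mono bezier_Q_le) auto
  also have "\<dots> = \<alpha> * (2 * (\<Sum>k\<le>n. Bernstein n k x * (real k / real n - x)\<^sup>2)
      + E * (\<Sum>k\<le>n. Bernstein n k x))"
    unfolding sum_distrib_left sum.distrib[symmetric] by (simp add: algebra_simps)
  also have "\<dots> = \<alpha> * (2 * (x * (1 - x) / real n) + E)"
    using n by (simp add: sum_Bernstein_square_dist)
  also have "\<dots> \<le> \<alpha> * ((14 + \<beta>\<^sup>2) / (4 * real n))"
  proof (rule mult_left_mono)
    \<comment> \<open>The three contributions are at most \<open>1 / (2 * n)\<close>,
      \<open>1 / n\<close> (as \<open>n \<ge> 2\<close>) and
      \<open>\<beta>\<^sup>2 / (4 * n)\<close>. They add up to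
      \<open>(6 + \<beta>\<^sup>2) / (4 * n)\<close>, below the stated constant.\<close>
    have "x * (1 - x) / real n \<le> (1 / 4) / real n"
      by (intro divide_right_mono quarter_bound) auto
    moreover have "2 / (real n)\<^sup>2 \<le> 1 / real n"
      using n by (simp add: power2_eq_square divide_simps)
    moreover have "(14 + \<beta>\<^sup>2) / (4 * real n) = (7 / 2) * (1 / real n) + \<beta>\<^sup>2 / (4 * real n)"
      using n by (simp add: field_simps)
    moreover have "1 / real n \<ge> 0"
      by simp
    ultimately show "2 * (x * (1 - x) / real n) + E \<le> (14 + \<beta>\<^sup>2) / (4 * real n)"
      unfolding E_def by linarith
  qed (use \<alpha> in simp)
  finally show ?thesis
    by (simp add: E_def algebra_simps)
qed

section \<open>Uniform norm, modulus of continuity and Lipschitz bound\<close>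

lemma abs_le_sup_norm01:
  assumes "continuous_on {0..1} g" "x \<in> {0..1}"
  shows "\<bar>g x\<bar> \<le> sup_norm01 g"
proof -
  have "compact ((\<lambda>x. \<bar>g x\<bar>) ` {0..1})"
    using assms by (intro compact_continuous_image continuous_intros) auto
  then show ?thesis
    unfolding sup_norm01_def using assms
    by (intro cSUP_upper bounded_imp_bdd_above compact_imp_bounded)
qed

text \<open>The pair \<open>s = t = 0\<close> contributes 0. For \<open>Sup\<close> to dominate it
  the set must be bounded above, which continuity on the compact interval ensures through twice the
  norm.\<close>

lemma modulus01_nonneg:
  assumes cont: "continuous_on {0..1} g" and "\<delta> \<ge> 0"
  shows "modulus01 g \<delta> \<ge> 0"
  unfolding modulus01_def
proof (rule cSup_upper)
  show "0 \<in> {\<bar>g s - g t\<bar> | s t. s \<in> {0..1} \<and> t \<in> {0..1} \<and> \<bar>s - t\<bar> \<le> \<delta>}"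
    using assms by (auto intro!: exI[of _ 0])
  show "bdd_above {\<bar>g s - g t\<bar> | s t. s \<in> {0..1} \<and> t \<in> {0..1} \<and> \<bar>s - t\<bar> \<le> \<delta>}"
  proof (rule bdd_aboveI[of _ "sup_norm01 g + sup_norm01 g"])
    fix z assume "z \<in> {\<bar>g s - g t\<bar> | s t. s \<in> {0..1} \<and> t \<in> {0..1} \<and> \<bar>s - t\<bar> \<le> \<delta>}"
    then obtain s t where "z = \<bar>g s - g t\<bar>" "s \<in> {0..1}" "t \<in> {0..1}"
      by auto
    with abs_le_sup_norm01[OF cont, of s] abs_le_sup_norm01[OF cont, of t]
    show "z \<le> sup_norm01 g + sup_norm01 g"
      by linarith
  qed
qed

lemma C1_on01_lipschitz:
  assumes "C1_on01 f f'" "s \<in> {0..1}" "t \<in> {0..1}"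
  shows "\<bar>f s - f t\<bar> \<le> sup_norm01 f' * \<bar>s - t\<bar>"
proof -
  have "norm (f s - f t) \<le> sup_norm01 f' * norm (s - t)"
    by (rule field_differentiable_bound[of "{0..1}" f f'])
      (use assms in \<open>auto simp: C1_on01_def intro: abs_le_sup_norm01\<close>)
  then show ?thesis
    by simp
qed

section \<open>The error estimate\<close>

theorem bezier_L_error_bound:
  assumes f: "C1_on01 f f'" and \<alpha>: "\<alpha> \<ge> 1" and \<beta>: "\<beta> \<in> {0..1}" and n: "n \<ge> 2" and x: "x \<in> {0..1}"
  shows "\<bar>bezier_L \<alpha> \<beta> n f x - f x\<bar> \<le> sqrt ((14 + \<beta>\<^sup>2) * \<alpha> / (4 * real n)) * sup_norm01 f'"
proof -
  define c where "c = sqrt ((14 + \<beta>\<^sup>2) * \<alpha> / (4 * real n))"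
  define M where "M = sup_norm01 f'"
  have "14 + \<beta>\<^sup>2 > 0"
    by (simp add: add_pos_nonneg)
  then have c: "c > 0" and c_sq: "c * c = (14 + \<beta>\<^sup>2) * \<alpha> / (4 * real n)"
    using \<alpha> n by (simp_all add: c_def)
  have "continuous_on {0..1} f'"
    using f by (simp add: C1_on01_def)
  from abs_le_sup_norm01[OF this x] have M: "M \<ge> 0"
    unfolding M_def by linarith
  have cont: "continuous_on {0..1} f"
    using f by (auto simp: C1_on01_def intro!: DERIV_continuous_on)
  have bound: "\<bar>f u - f x\<bar> \<le> M * c / 2 + M / (2 * c) * (u - x)\<^sup>2" if "u \<in> {0..1}" for u
  proof -
    \<comment> \<open>AM-GM, from the square of \<open>\<bar>u - x\<bar> - c\<close>. It replaces
      the first absolute moment by the second, so no Cauchy-Schwarz inequality for the operator is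
      required.\<close>
    have "\<bar>u - x\<bar> * (2 * c) \<le> c * c + (u - x)\<^sup>2"
      using zero_le_power2[of "\<bar>u - x\<bar> - c"] by (simp add: power2_diff power2_eq_square algebra_simps)
    then have "\<bar>u - x\<bar> \<le> c / 2 + (u - x)\<^sup>2 / (2 * c)"
      using c by (simp add: field_simps)
    then have "M * \<bar>u - x\<bar> \<le> M * (c / 2 + (u - x)\<^sup>2 / (2 * c))"
      using M by (rule mult_left_mono)
    with C1_on01_lipschitz[OF f that x] show ?thesis
      by (simp add: M_def algebra_simps)
  qed
  define W where "W k = 2 * (real k / real n - x)\<^sup>2 + 2 / (real n)\<^sup>2 + \<beta>\<^sup>2 / (4 * real n)" for k
  \<comment> \<open>The weights sum to 1, so \<open>f x\<close> can be moved inside the sum.\<close>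
  have "bezier_L \<alpha> \<beta> n f x - f x = (\<Sum>k\<le>n. bezier_Q \<alpha> n k x * (node_functional \<beta> n f k - f x))"
    using n by (simp add: bezier_L_eq_sum right_diff_distrib sum_subtractf sum_bezier_Q
        flip: sum_distrib_right)
  also have "\<bar>\<dots>\<bar> \<le> (\<Sum>k\<le>n. \<bar>bezier_Q \<alpha> n k x * (node_functional \<beta> n f k - f x)\<bar>)"
    by (rule sum_abs)
  also have "\<dots> \<le> (\<Sum>k\<le>n. bezier_Q \<alpha> n k x * (M * c / 2 + M / (2 * c) * W k))"
  proof (rule sum_mono)
    fix k assume "k \<in> {..n}"
    then have k: "k \<le> n" by simp
    have "\<bar>node_functional \<beta> n f k - f x\<bar> \<le> M * c / 2 + M / (2 * c) * W k"
      unfolding W_def using M c by (intro node_functional_quadratic_bound cont \<beta> n k bound) auto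
    with bezier_Q_nonneg[OF x \<alpha> k]
    show "\<bar>bezier_Q \<alpha> n k x * (node_functional \<beta> n f k - f x)\<bar>
        \<le> bezier_Q \<alpha> n k x * (M * c / 2 + M / (2 * c) * W k)"
      by (simp add: abs_mult mult_left_mono)
  qed
  also have "\<dots> = M * c / 2 * (\<Sum>k\<le>n. bezier_Q \<alpha> n k x) + M / (2 * c) * (\<Sum>k\<le>n. bezier_Q \<alpha> n k x * W k)"
    unfolding sum_distrib_left sum.distrib[symmetric] by (simp add: algebra_simps)
  \<comment> \<open>With \<open>c * c\<close> as the second moment bound, both summands equal
    \<open>M * c / 2\<close>; this balance dictates the choice of \<open>c\<close>.\<close>
  also have "\<dots> \<le> M * c / 2 * 1 + M / (2 * c) * (c * c)"
    unfolding sum_bezier_Q W_def c_sq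
    using M c by (intro add_left_mono mult_left_mono sum_bezier_Q_second_moment x \<alpha> n) auto
  also have "\<dots> = c * M"
    using c by simp
  finally show ?thesis
    by (simp add: c_def M_def)
qed

theorem theorem3:
  fixes f f' :: "real \<Rightarrow> real" and \<alpha> \<beta> x :: real and n :: nat
  assumes "C1_on01 f f'"
    and "\<alpha> \<ge> 1"
    and "\<beta> \<in> {0..1}"
    and "n \<ge> 2"
    and "x \<in> {0..1}"
  shows "\<bar>bezier_L \<alpha> \<beta> n f x - f x\<bar>
    \<le> sqrt ((14 + \<beta>\<^sup>2) * \<alpha> / (4 * real n)) *
       (sup_norm01 f' + modulus01 f' (1 / sqrt (real n)) * (1 + sqrt ((14 + \<beta>\<^sup>2) * \<alpha> / 4)))"
proof -
  have "modulus01 f' (1 / sqrt (real n)) \<ge> 0"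
    using assms by (intro modulus01_nonneg) (auto simp: C1_on01_def)
  then have "modulus01 f' (1 / sqrt (real n)) * (1 + sqrt ((14 + \<beta>\<^sup>2) * \<alpha> / 4)) \<ge> 0"
    using assms by (intro mult_nonneg_nonneg add_nonneg_nonneg) auto
  then have "sqrt ((14 + \<beta>\<^sup>2) * \<alpha> / (4 * real n)) * sup_norm01 f'
      \<le> sqrt ((14 + \<beta>\<^sup>2) * \<alpha> / (4 * real n)) *
       (sup_norm01 f' + modulus01 f' (1 / sqrt (real n)) * (1 + sqrt ((14 + \<beta>\<^sup>2) * \<alpha> / 4)))"
    using assms by (intro mult_left_mono) auto
  with bezier_L_error_bound[OF assms] show ?thesis
    by (rule order_trans)
qed

end
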